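(* The following three equalities hold: $$\prod_{n\ge0}\left(\frac{(4n+1)(4n+4)}{(4n+2)(4n+3)}\right)^{t_n}=\frac{\pi^{3/4}\sqrt2}{\Gamma(1/4)},$$ $$\prod_{n\ge0}\left(\frac{(n+1)(4n+5)}{(n+2)(4n+1)}\right)^{t_n}=\sqrt2,$$ $$\prod_{n\ge0}\left(\frac{(8n+1)(8n+7)}{(8n+3)(8n+5)}\right)^{t_n}=\sqrt{2\sqrt2-2}.$$
   Context: For an integer $n\ge 0$, $t_n\in\{0,1\}$ denotes the sum modulo $2$ of the binary digits of $n$ (the Thue-Morse sequence $0,1,1,0,1,0,0,1,\ldots$); equivalently $t_0=0$, $t_{2n}=t_n$, $t_{2n+1}=1-t_n$. $\Gamma$ is Euler's Gamma function. Infinite products are limits of the partial products taken in increasing order of $n$. *)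

theory Defs
  imports "HOL-Analysis.Analysis"
begin

text \<open>The binary digit of \<open>n\<close> at position \<open>k\<close> is \<open>n div 2 ^ k mod 2\<close>. Since \<open>n < 2 ^ n\<close>, the
  digits at positions \<open>k \<ge> n\<close> are zero, so the sum below runs over all nonzero digits.\<close>

definition thue_morse :: "nat \<Rightarrow> nat" where
  "thue_morse n = (\<Sum>k<n. n div 2 ^ k mod 2) mod 2"

lemma binary_digit_sum_extend:
  assumes "n \<le> m"
  shows "(\<Sum>k<m. n div 2 ^ k mod 2) = (\<Sum>k<n. n div 2 ^ k mod (2::nat))"
proof (rule sum.mono_neutral_right)
  show "\<forall>i\<in>{..<m} - {..<n}. n div 2 ^ i mod 2 = 0"
  proof
    fix i assume "i \<in> {..<m} - {..<n}"
    then have "n < 2 ^ i"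
      by (auto intro: le_less_trans[of n i])
    then show "n div 2 ^ i mod 2 = 0" by simp
  qed
qed (use assms in auto)

lemma thue_morse_0: "thue_morse 0 = 0"
  by (simp add: thue_morse_def)

lemma thue_morse_double: "thue_morse (2 * n) = thue_morse n"
proof -
  have "(\<Sum>k<2 * n. 2 * n div 2 ^ k mod 2) = (\<Sum>k<Suc (2 * n). 2 * n div 2 ^ k mod (2::nat))"
    by (rule binary_digit_sum_extend[symmetric]) simp
  also have "\<dots> = (\<Sum>k<2 * n. n div 2 ^ k mod 2)"
    by (subst sum.lessThan_Suc_shift) (simp add: div_mult2_eq)
  also have "\<dots> = (\<Sum>k<n. n div 2 ^ k mod 2)"
    by (rule binary_digit_sum_extend) simp
  finally show ?thesis by (simp add: thue_morse_def)
qed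

lemma thue_morse_double_plus_1: "thue_morse (2 * n + 1) = 1 - thue_morse n"
proof -
  have "(\<Sum>k<2 * n + 1. (2 * n + 1) div 2 ^ k mod 2) = 1 + (\<Sum>k<2 * n. n div 2 ^ k mod (2::nat))"
    unfolding Suc_eq_plus1[symmetric]
    by (subst sum.lessThan_Suc_shift) (simp add: div_mult2_eq)
  also have "(\<Sum>k<2 * n. n div 2 ^ k mod 2) = (\<Sum>k<n. n div 2 ^ k mod (2::nat))"
    by (rule binary_digit_sum_extend) simp
  finally have "thue_morse (2 * n + 1) = (1 + (\<Sum>k<n. n div 2 ^ k mod 2)) mod 2"
    by (simp add: thue_morse_def)
  then show ?thesis unfolding thue_morse_def by presburger
qed

end

theory Submission
  imports Defs "HOL-Probability.Characteristic_Functions"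
begin

text \<open>Write \<open>s\<^sub>n = (-1)\<^bsup>t\<^sub>n\<^esup>\<close>. Since \<open>t\<^sub>n = (1 - s\<^sub>n) / 2\<close>, the square of each product is
  \<open>\<Prod>a\<^sub>n\<close> divided by \<open>\<Prod>a\<^sub>n\<^bsup>s\<^sub>n\<^esup>\<close>. The former is a quotient of Gamma values. The logarithm of the
  latter is a combination of values of \<open>h(x) = \<Sum>s\<^sub>n ln(n + x)\<close>, summed in pairs; splitting into even
  and odd \<open>n\<close> gives \<open>h(x) = h(x/2) - h((x + 1)/2)\<close>, since the resulting constants \<open>s\<^sub>n ln 2\<close> cancel
  in pairs. Comparing both sides at \<open>x = 0\<close> without the term \<open>n = 0\<close> gives \<open>h(1/2) = - ln 2\<close>, and
  these relations determine the three combinations that occur.\<close>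

section \<open>Thue-Morse signs and signed series\<close>

definition tm_sign :: "nat \<Rightarrow> real" where
  "tm_sign n = (- 1) ^ thue_morse n"

lemma thue_morse_cases: "thue_morse n = 0 \<or> thue_morse n = 1"
  unfolding thue_morse_def by linarith

lemma tm_sign_0 [simp]: "tm_sign 0 = 1"
  by (simp add: tm_sign_def thue_morse_0)

lemma tm_sign_double [simp]: "tm_sign (2 * n) = tm_sign n"
  by (simp add: tm_sign_def thue_morse_double)

lemma tm_sign_double_plus_1 [simp]: "tm_sign (Suc (2 * n)) = - tm_sign n"
  using thue_morse_cases[of n] thue_morse_double_plus_1[of n] by (auto simp: tm_sign_def)

lemma abs_tm_sign [simp]: "\<bar>tm_sign n\<bar> = 1"
  by (simp add: tm_sign_def power_abs)

lemma sum_lessThan_double: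
  fixes f :: "nat \<Rightarrow> 'a::comm_monoid_add"
  shows "(\<Sum>n<2 * N. f n) = (\<Sum>n<N. f (2 * n) + f (Suc (2 * n)))"
  by (induction N) (simp_all add: add.assoc)

lemma sum_tm_sign_mult_double:
  "(\<Sum>n<2 * N. tm_sign n * f n) = (\<Sum>n<N. tm_sign n * (f (2 * n) - f (Suc (2 * n))))"
  unfolding sum_lessThan_double by (simp add: right_diff_distrib)

text \<open>A partial sum of odd length differs from one of even length by a single term, which
  vanishes in the limit.\<close>

lemma LIMSEQ_sum_from_double:
  fixes f :: "nat \<Rightarrow> real"
  assumes "(\<lambda>N. \<Sum>n<2 * N. f n) \<longlonglongrightarrow> l" "f \<longlonglongrightarrow> 0"
  shows "(\<lambda>N. \<Sum>n<N. f n) \<longlonglongrightarrow> l"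
proof (rule limseq_even_odd)
  have "(\<lambda>N. f (2 * N)) \<longlonglongrightarrow> 0"
    using LIMSEQ_linear[OF assms(2), of 2] by (simp add: mult.commute)
  then show "(\<lambda>N. \<Sum>n<2 * N + 1. f n) \<longlonglongrightarrow> l"
    using tendsto_add[OF assms(1)] by fastforce
qed fact

text \<open>Pairing terms turns the signs into differences of neighbours. By monotonicity these are
  dominated by the telescoping \<open>g (2 * Suc n) - g (2 * n)\<close>, so the paired series
  converges absolutely.\<close>

lemma summable_tm_sign_mult:
  fixes g :: "nat \<Rightarrow> real"
  assumes mono: "\<And>n. n \<ge> n0 \<Longrightarrow> g n \<le> g (Suc n)" and lim: "g \<longlonglongrightarrow> 0"
  shows "summable (\<lambda>n. tm_sign n * g n)"
proof -
  have lim2: "(\<lambda>n. g (2 * n)) \<longlonglongrightarrow> 0"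
    using LIMSEQ_linear[OF lim, of 2] by (simp add: mult.commute)
  have "summable (\<lambda>n. tm_sign n * (g (2 * n) - g (Suc (2 * n))))"
  proof (rule summable_comparison_test)
    show "summable (\<lambda>n. g (2 * Suc n) - g (2 * n))"
      by (rule telescope_summable[OF lim2])
    show "\<exists>N. \<forall>n\<ge>N. norm (tm_sign n * (g (2 * n) - g (Suc (2 * n)))) \<le> g (2 * Suc n) - g (2 * n)"
    proof (intro exI allI impI)
      fix n assume "n \<ge> n0"
      then show "norm (tm_sign n * (g (2 * n) - g (Suc (2 * n)))) \<le> g (2 * Suc n) - g (2 * n)"
        using mono[of "2 * n"] mono[of "Suc (2 * n)"] by (simp add: abs_mult)
    qed
  qed
  then obtain l where "(\<lambda>N. \<Sum>n<N. tm_sign n * (g (2 * n) - g (Suc (2 * n)))) \<longlonglongrightarrow> l"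
    unfolding summable_def sums_def by blast
  then have "(\<lambda>N. \<Sum>n<2 * N. tm_sign n * g n) \<longlonglongrightarrow> l"
    by (simp only: sum_tm_sign_mult_double)
  moreover have "(\<lambda>n. tm_sign n * g n) \<longlonglongrightarrow> 0"
    by (rule tendsto_rabs_zero_cancel) (simp add: abs_mult tendsto_rabs_zero lim)
  ultimately show ?thesis
    unfolding summable_def sums_def by (blast intro: LIMSEQ_sum_from_double)
qed

section \<open>The logarithmic series and its functional equation\<close>

text \<open>Only partial sums of even length are used: the full series has terms of modulus tending to
  infinity. At \<open>x = 0\<close> the convention \<^term>\<open>ln (0::real) = 0\<close> removes the term \<open>n = 0\<close>.\<close>

definition tm_log :: "real \<Rightarrow> real" where
  "tm_log x = lim (\<lambda>N. \<Sum>n<2 * N. tm_sign n * ln (real n + x))"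

lemma tm_log_LIMSEQ:
  assumes "x \<ge> 0"
  shows "(\<lambda>N. \<Sum>n<2 * N. tm_sign n * ln (real n + x)) \<longlonglongrightarrow> tm_log x"
proof -
  define g where "g n = ln (2 * real n + x) - ln (2 * real n + 1 + x)" for n
  have "summable (\<lambda>n. tm_sign n * g n)"
  proof (rule summable_tm_sign_mult)
    \<comment> \<open>Monotonicity starts at 1: for \<open>x = 0\<close> the convention
      \<open>ln 0 = 0\<close> makes \<open>g 0 = 0\<close>, while \<open>g 1 < 0\<close>.\<close>
    fix n :: nat assume n: "n \<ge> 1"
    define y where "y = 2 * real n + x"
    have "y > 0" using n assms by (simp add: y_def)
    then have "y * (y + 3) \<le> (y + 1) * (y + 2)" by (simp add: algebra_simps)
    then have "ln (y * (y + 3)) \<le> ln ((y + 1) * (y + 2))"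
      using \<open>y > 0\<close> by (subst ln_le_cancel_iff) auto
    then have "ln y + ln (y + 3) \<le> ln (y + 1) + ln (y + 2)"
      using \<open>y > 0\<close> by (simp add: ln_mult)
    then show "g n \<le> g (Suc n)"
      by (simp add: g_def y_def algebra_simps)
  next
    show "g \<longlonglongrightarrow> 0" unfolding g_def by real_asymp
  qed
  then have "convergent (\<lambda>N. \<Sum>n<N. tm_sign n * g n)"
    by (simp add: summable_iff_convergent)
  moreover have "(\<Sum>n<2 * N. tm_sign n * ln (real n + x)) = (\<Sum>n<N. tm_sign n * g n)" for N
    unfolding sum_tm_sign_mult_double g_def by (intro sum.cong) (auto simp: algebra_simps)
  ultimately show ?thesis
    unfolding tm_log_def by (simp add: convergent_LIMSEQ_iff)
qed

lemma tm_log_duplication: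
  assumes "x > 0"
  shows "tm_log x = tm_log (x / 2) - tm_log ((x + 1) / 2)"
proof (rule LIMSEQ_unique)
  let ?S = "\<lambda>x N. \<Sum>n<2 * N. tm_sign n * ln (real n + x)"
  \<comment> \<open>The left side has 4N terms, that is 2N pairs, so both sums on the right again
    have even length. Within a pair the two copies of \<open>ln 2\<close> cancel.\<close>
  have "?S x (2 * N) = ?S (x / 2) N - ?S ((x + 1) / 2) N" for N
  proof -
    have "tm_sign n * (ln (real (2 * n) + x) - ln (real (Suc (2 * n)) + x)) =
          tm_sign n * ln (real n + x / 2) - tm_sign n * ln (real n + (x + 1) / 2)" for n
    proof -
      have "real (2 * n) + x = 2 * (real n + x / 2)"
           "real (Suc (2 * n)) + x = 2 * (real n + (x + 1) / 2)" by (simp_all add: field_simps)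
      moreover have "real n + x / 2 > 0" "real n + (x + 1) / 2 > 0"
        using assms by (simp_all add: add_nonneg_pos)
      ultimately show ?thesis
        by (simp only: ln_mult zero_less_numeral) (simp add: right_diff_distrib)
    qed
    then show ?thesis
      unfolding sum_tm_sign_mult_double[of _ "2 * N"] by (simp add: sum_subtractf)
  qed
  moreover have "(\<lambda>N. ?S x (2 * N)) \<longlonglongrightarrow> tm_log x"
    using LIMSEQ_linear[OF tm_log_LIMSEQ[of x], of 2] assms by (simp add: mult.commute)
  ultimately show "(\<lambda>N. ?S (x / 2) N - ?S ((x + 1) / 2) N) \<longlonglongrightarrow> tm_log x"
    by simp
  show "(\<lambda>N. ?S (x / 2) N - ?S ((x + 1) / 2) N) \<longlonglongrightarrow> tm_log (x / 2) - tm_log ((x + 1) / 2)"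
    using assms by (intro tendsto_diff tm_log_LIMSEQ) auto
qed

lemma tm_log_half: "tm_log (1 / 2) = - ln 2"
proof -
  let ?S = "\<lambda>x N. \<Sum>n<2 * N. tm_sign n * ln (real n + x)"
  have eq: "?S 0 (2 * N) = ?S 0 N - ?S (1 / 2) N - ln 2" if "N > 0" for N
  proof -
    \<comment> \<open>For \<open>n > 0\<close> both logarithms on the left release a
      \<open>ln 2\<close>. For \<open>n = 0\<close> only the odd one does, because
      \<open>ln 0 = 0\<close>; this leaves one uncancelled \<open>ln 2\<close>.\<close>
    have "tm_sign n * (ln (real (2 * n)) - ln (real (Suc (2 * n)))) =
          tm_sign n * ln (real n) - tm_sign n * ln (real n + 1 / 2) - (if n = 0 then ln 2 else 0)" for n
    proof -
      have "ln (real (Suc (2 * n))) = ln (2 * (real n + 1 / 2))" by (simp add: field_simps)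
      also have "\<dots> = ln 2 + ln (real n + 1 / 2)" by (subst ln_mult) auto
      finally show ?thesis
        by (cases "n = 0") (simp_all only:, simp_all add: ln_mult ln_div right_diff_distrib distrib_left)
    qed
    then have "?S 0 (2 * N) = ?S 0 N - ?S (1 / 2) N - (\<Sum>n<2 * N. if n = 0 then ln 2 else 0)"
      unfolding sum_tm_sign_mult_double[of _ "2 * N"] by (simp add: sum_subtractf)
    then show ?thesis using that by (simp add: sum.delta)
  qed
  have "(\<lambda>N. ?S 0 (2 * N)) \<longlonglongrightarrow> tm_log 0"
    using LIMSEQ_linear[OF tm_log_LIMSEQ[of 0], of 2] by (simp add: mult.commute)
  moreover have "(\<lambda>N. ?S 0 N - ?S (1 / 2) N - ln 2) \<longlonglongrightarrow> tm_log 0 - tm_log (1 / 2) - ln 2"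
    by (intro tendsto_diff tm_log_LIMSEQ tendsto_const) auto
  then have "(\<lambda>N. ?S 0 (2 * N)) \<longlonglongrightarrow> tm_log 0 - tm_log (1 / 2) - ln 2"
    by (rule Lim_transform_eventually)
       (use eq in \<open>auto intro!: eventually_mono[OF eventually_gt_at_top[of 0]]\<close>)
  \<comment> \<open>The unknown finite value \<open>tm_log 0\<close> cancels.\<close>
  ultimately have "tm_log 0 = tm_log 0 - tm_log (1 / 2) - ln 2"
    by (rule LIMSEQ_unique)
  then show ?thesis by simp
qed

text \<open>The four logarithmic sums are controlled only along even lengths. Their combination has
  terms tending to zero, since the quotient tends to 1, so it converges along all lengths.\<close>

lemma sum_tm_sign_ln_LIMSEQ:
  assumes "a > 0" "b > 0" "c > 0" "d > 0"
  shows "(\<lambda>N. \<Sum>n<N. tm_sign n *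
            ln (((real n + a) * (real n + b)) / ((real n + c) * (real n + d))))
           \<longlonglongrightarrow> tm_log a + tm_log b - tm_log c - tm_log d"
proof (rule LIMSEQ_sum_from_double)
  let ?f = "\<lambda>n. ln (((real n + a) * (real n + b)) / ((real n + c) * (real n + d)))"
  have "?f n = ln (real n + a) + ln (real n + b) - ln (real n + c) - ln (real n + d)" for n
  proof -
    have "real n + a > 0" "real n + b > 0" "real n + c > 0" "real n + d > 0"
      using assms by simp_all
    then show ?thesis by (simp add: ln_div ln_mult)
  qed
  then have "tm_sign n * ?f n = tm_sign n * ln (real n + a) + tm_sign n * ln (real n + b)
          - tm_sign n * ln (real n + c) - tm_sign n * ln (real n + d)" for n
    by (simp only: right_diff_distrib distrib_left)
  then show "(\<lambda>N. \<Sum>n<2 * N. tm_sign n * ?f n) \<longlonglongrightarrow> tm_log a + tm_log b - tm_log c - tm_log d"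
    using assms
    by (simp only: sum_subtractf sum.distrib) (intro tendsto_diff tendsto_add tm_log_LIMSEQ; simp)
  have "?f \<longlonglongrightarrow> 0" by real_asymp
  then show "(\<lambda>n. tm_sign n * ?f n) \<longlonglongrightarrow> 0"
    by (intro tendsto_rabs_zero_cancel[of "\<lambda>n. tm_sign n * ?f n"]) (simp add: abs_mult tendsto_rabs_zero)
qed

section \<open>Gamma quotients and products with Thue-Morse exponents\<close>

lemma Gamma_real_nonzero: "x > 0 \<Longrightarrow> Gamma x \<noteq> 0" for x :: real
  by (metis Gamma_real_pos less_irrefl)

text \<open>In a quotient of Gamma series the factorials cancel, and \<open>a + b = c + d\<close>
  cancels the powers of \<open>N\<close>. What remains is a quotient of Pochhammer products with
  \<open>N + 1\<close> factors each, hence the shift by \<open>Suc\<close>.\<close>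

lemma prod_rational_LIMSEQ_Gamma:
  fixes a b c d :: real
  assumes "a > 0" "b > 0" "c > 0" "d > 0" "a + b = c + d"
  shows "(\<lambda>N. \<Prod>n<N. ((real n + a) * (real n + b)) / ((real n + c) * (real n + d)))
           \<longlonglongrightarrow> (Gamma c * Gamma d) / (Gamma a * Gamma b)"
proof -
  let ?G = "\<lambda>N. (Gamma_series c N * Gamma_series d N) / (Gamma_series a N * Gamma_series b N)"
  have "?G N = (\<Prod>n<Suc N. ((real n + a) * (real n + b)) / ((real n + c) * (real n + d)))" for N
  proof -
    define L where "L = ln (real N)"
    have poch: "pochhammer z (N + 1) = (\<Prod>n<Suc N. real n + z)" for z :: real
      unfolding pochhammer_prod atLeast0LessThan by (simp add: add.commute)
    have pos: "(\<Prod>n<Suc N. real n + z) > 0" if "z > 0" for z :: real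
      using that by (intro prod_pos) auto
    have "exp (c * L) * exp (d * L) = exp (a * L) * exp (b * L)"
      using assms(5) by (simp flip: exp_add distrib_right)
    then show ?thesis
      unfolding Gamma_series_def poch prod_dividef prod.distrib
      using pos[of a] pos[of b] pos[of c] pos[of d] assms
      by (simp add: L_def field_simps del: prod.lessThan_Suc)
  qed
  moreover have "?G \<longlonglongrightarrow> (Gamma c * Gamma d) / (Gamma a * Gamma b)"
    using assms by (intro tendsto_divide tendsto_mult Gamma_series_LIMSEQ) (simp add: Gamma_real_nonzero)
  ultimately show ?thesis
    by (subst filterlim_sequentially_Suc[symmetric]) simp
qed

text \<open>As 2t = 1 - s for an exponent t with sign s, each squared factor is \<open>f n\<close>
  times \<open>f n\<close> to the power -s. Positivity allows logarithms and the final square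
  root.\<close>

lemma has_prod_power_thue_morse:
  fixes f :: "nat \<Rightarrow> real"
  assumes pos: "\<And>n. f n > 0" and "A > 0"
    and prod: "(\<lambda>N. \<Prod>n<N. f n) \<longlonglongrightarrow> A"
    and sum: "(\<lambda>N. \<Sum>n<N. tm_sign n * ln (f n)) \<longlonglongrightarrow> S"
  shows "(\<lambda>n. f n ^ thue_morse n) has_prod sqrt (A * exp (- S))"
proof -
  have "f n * exp (- (tm_sign n * ln (f n))) = (f n ^ thue_morse n)\<^sup>2" for n
    using pos[of n] thue_morse_cases[of n]
    by (auto simp: tm_sign_def exp_minus power2_eq_square)
  then have "(\<Prod>n<N. f n) * exp (- (\<Sum>n<N. tm_sign n * ln (f n))) = (\<Prod>n<N. f n ^ thue_morse n)\<^sup>2" for N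
    by (simp add: exp_sum prod_power_distrib flip: sum_negf prod.distrib)
  then have "sqrt ((\<Prod>n<N. f n) * exp (- (\<Sum>n<N. tm_sign n * ln (f n)))) = (\<Prod>n<N. f n ^ thue_morse n)" for N
    using pos by (simp add: prod_nonneg less_imp_le)
  moreover have "(\<lambda>N. sqrt ((\<Prod>n<N. f n) * exp (- (\<Sum>n<N. tm_sign n * ln (f n)))))
      \<longlonglongrightarrow> sqrt (A * exp (- S))"
    by (intro tendsto_intros prod sum)
  ultimately have "(\<lambda>N. \<Prod>n<N. f n ^ thue_morse n) \<longlonglongrightarrow> sqrt (A * exp (- S))"
    by simp
  then show ?thesis
    \<comment> \<open>\<open>has_prod\<close> demands a nonzero limit, which \<open>A > 0\<close>
      supplies.\<close>
    unfolding has_prod_def raw_has_prod_def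
    using \<open>A > 0\<close> LIMSEQ_lessThan_iff_atMost[of "prod (\<lambda>n. f n ^ thue_morse n)"] by simp
qed

lemma has_prod_thue_morse_Gamma:
  fixes a b c d :: real
  assumes "a > 0" "b > 0" "c > 0" "d > 0" "a + b = c + d"
  shows "(\<lambda>n. (((real n + a) * (real n + b)) / ((real n + c) * (real n + d))) ^ thue_morse n)
     has_prod sqrt ((Gamma c * Gamma d) / (Gamma a * Gamma b) *
                    exp (- (tm_log a + tm_log b - tm_log c - tm_log d)))"
  by (rule has_prod_power_thue_morse)
     (use assms in \<open>auto intro!: prod_rational_LIMSEQ_Gamma sum_tm_sign_ln_LIMSEQ divide_pos_pos
        mult_pos_pos Gamma_real_pos add_nonneg_pos\<close>)

section \<open>Evaluation of the three products\<close>

lemma Gamma_reflection_real: "Gamma x * Gamma (1 - x) = pi / sin (pi * x)" for x :: real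
proof -
  have "complex_of_real (Gamma x * Gamma (1 - x)) = complex_of_real (pi / sin (pi * x))"
    using Gamma_reflection_complex[of "of_real x"] Gamma_complex_of_real[of "1 - x"]
    by (simp add: Gamma_complex_of_real sin_of_real flip: of_real_mult)
  then show ?thesis by (simp only: of_real_eq_iff)
qed

text \<open>By the half-angle formula. This is the value of the Gamma quotient in the third
  product.\<close>

lemma tan_pi_div_8: "tan (pi / 8) = sqrt 2 - 1"
proof -
  have "tan (pi / 8) = (sqrt 2 / 2) / (sqrt 2 / 2 + 1)"
    by (simp add: tan_half sin_45 cos_45)
  also have "\<dots> = sqrt 2 - 1"
  proof -
    have "sqrt 2 / 2 + 1 > (0::real)" by (simp add: add_pos_pos)
    moreover have "(sqrt 2 - 1) * (sqrt 2 / 2 + 1) = sqrt 2 / 2"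
      by (simp add: field_simps)
    ultimately show ?thesis
      by (subst divide_eq_eq) auto
  qed
  finally show ?thesis .
qed

theorem theorem4p2:
  shows "(\<lambda>n. (((4 * real n + 1) * (4 * real n + 4)) /
               ((4 * real n + 2) * (4 * real n + 3))) ^ thue_morse n)
           has_prod (pi powr (3/4) * sqrt 2 / Gamma (1/4))
       \<and> (\<lambda>n. (((real n + 1) * (4 * real n + 5)) /
               ((real n + 2) * (4 * real n + 1))) ^ thue_morse n)
           has_prod sqrt 2
       \<and> (\<lambda>n. (((8 * real n + 1) * (8 * real n + 7)) /
               ((8 * real n + 3) * (8 * real n + 5))) ^ thue_morse n)
           has_prod sqrt (2 * sqrt 2 - 2)"
proof (intro conjI)
  \<comment> \<open>At \<open>x = 1\<close> the duplication formula has \<open>tm_log 1\<close> on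
    both sides; at \<open>x = 1/2\<close> it gives the difference below.\<close>
  have log1: "tm_log 1 = - ln 2 / 2"
    using tm_log_duplication[of 1] tm_log_half by simp
  have log_half: "tm_log (1/4) - tm_log (3/4) = - ln 2"
    using tm_log_duplication[of "1/2"] tm_log_half by simp
  have exp_half: "exp (ln 2 / 2) = sqrt (2::real)"
    by (simp add: ln_sqrt [symmetric])

  have Gamma_3_4: "Gamma (3/4) = pi * sqrt 2 / Gamma (1/4 :: real)"
  proof -
    have "Gamma (1/4) * Gamma (3/4 :: real) = pi / (sqrt 2 / 2)"
      using Gamma_reflection_real[of "1/4"] by (simp add: sin_45)
    also have "\<dots> = pi * sqrt 2" by (simp add: divide_eq_eq)
    finally show ?thesis by (simp add: eq_divide_eq mult.commute Gamma_real_nonzero)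
  qed
  have "sqrt ((Gamma (1/2) * Gamma (3/4)) / (Gamma (1/4) * Gamma 1) *
          exp (- (tm_log (1/4) + tm_log 1 - tm_log (1/2) - tm_log (3/4)))) =
        pi powr (3/4) * sqrt 2 / Gamma (1/4)"
  proof (rule real_sqrt_unique)
    have "- (tm_log (1/4) + tm_log 1 - tm_log (1/2) - tm_log (3/4)) = ln 2 / 2"
      using log1 log_half tm_log_half by simp
    \<comment> \<open>Here \<open>pi\<close> will come from reflection at 1/4 and
      \<open>sqrt pi\<close> from \<open>Gamma (1/2)\<close>.\<close>
    moreover have "(pi powr (3/4))\<^sup>2 = pi * sqrt pi"
      by (simp add: power2_eq_square powr_half_sqrt[symmetric] powr_mult_base flip: powr_add)
    ultimately show "(pi powr (3/4) * sqrt 2 / Gamma (1/4))\<^sup>2 =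
        (Gamma (1/2) * Gamma (3/4)) / (Gamma (1/4) * Gamma 1) *
          exp (- (tm_log (1/4) + tm_log 1 - tm_log (1/2) - tm_log (3/4)))"
      by (simp only: exp_half power_mult_distrib power_divide)
        (simp add: Gamma_3_4 Gamma_one_half_real power2_eq_square)
  qed (simp add: less_imp_le)
  moreover have "((4 * real n + 1) * (4 * real n + 4)) / ((4 * real n + 2) * (4 * real n + 3)) =
      ((real n + 1/4) * (real n + 1)) / ((real n + 1/2) * (real n + 3/4))" for n
    by (simp add: divide_simps) (simp add: algebra_simps)
  ultimately show "(\<lambda>n. (((4 * real n + 1) * (4 * real n + 4)) /
      ((4 * real n + 2) * (4 * real n + 3))) ^ thue_morse n)
        has_prod (pi powr (3/4) * sqrt 2 / Gamma (1/4))"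
    using has_prod_thue_morse_Gamma[of "1/4" 1 "1/2" "3/4"] by simp

  have Gamma2: "Gamma (2::real) = 1" "Gamma (5/4 :: real) = Gamma (1/4) / 4"
  proof -
    have "(1/4 :: real) \<notin> \<int>\<^sub>\<le>\<^sub>0"
      by (auto dest: nonpos_Ints_nonpos)
    then show "Gamma (2::real) = 1" "Gamma (5/4 :: real) = Gamma (1/4) / 4"
      using Gamma_plus1[of "1::real"] Gamma_plus1[of "1/4 :: real"] by simp_all
  qed
  \<comment> \<open>Duplication at 2 and then at 3/2 gives
    \<open>tm_log 1 - tm_log 2 = tm_log (3/4) - tm_log (5/4)\<close>, which reduces the bracket to
    \<open>tm_log (3/4) - tm_log (1/4)\<close>.\<close>
  have "- (tm_log 1 + tm_log (5/4) - tm_log 2 - tm_log (1/4)) = - ln 2"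
    using tm_log_duplication[of 2] tm_log_duplication[of "3/2"] log_half by simp
  then have "sqrt ((Gamma 2 * Gamma (1/4)) / (Gamma 1 * Gamma (5/4)) *
          exp (- (tm_log 1 + tm_log (5/4) - tm_log 2 - tm_log (1/4)))) = sqrt 2"
    by (simp only: Gamma2) (simp add: exp_minus Gamma_real_nonzero)
  moreover have "((real n + 1) * (4 * real n + 5)) / ((real n + 2) * (4 * real n + 1)) =
      ((real n + 1) * (real n + 5/4)) / ((real n + 2) * (real n + 1/4))" for n
    by (simp add: divide_simps) (simp add: algebra_simps)
  ultimately show "(\<lambda>n. (((real n + 1) * (4 * real n + 5)) /
      ((real n + 2) * (4 * real n + 1))) ^ thue_morse n) has_prod sqrt 2"
    using has_prod_thue_morse_Gamma[of 1 "5/4" 2 "1/4"] by simp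

  \<comment> \<open>Duplication at 1/4 yields the pair 1/8, 5/8 and at 3/4 the pair 3/8, 7/8; the
    bracket is \<open>tm_log (1/4) - tm_log (3/4)\<close>.\<close>
  have "- (tm_log (1/8) + tm_log (7/8) - tm_log (3/8) - tm_log (5/8)) = ln 2"
    using tm_log_duplication[of "1/4"] tm_log_duplication[of "3/4"] log_half by simp
  \<comment> \<open>Reflection pairs 3/8 with 5/8 and 1/8 with 7/8, so the quotient is
    \<open>sin (pi/8) / sin (3*pi/8) = tan (pi/8)\<close>.\<close>
  moreover have "(Gamma (3/8) * Gamma (5/8)) / (Gamma (1/8) * Gamma (7/8 :: real)) = sqrt 2 - 1"
  proof -
    have "sin (pi * 3 / 8) = cos (pi / 8)"
      by (simp add: sin_cos_eq field_simps)
    then show ?thesis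
      using Gamma_reflection_real[of "1/8"] Gamma_reflection_real[of "3/8"] tan_pi_div_8
      by (simp add: tan_def)
  qed
  ultimately have "sqrt ((Gamma (3/8) * Gamma (5/8)) / (Gamma (1/8) * Gamma (7/8)) *
          exp (- (tm_log (1/8) + tm_log (7/8) - tm_log (3/8) - tm_log (5/8)))) =
        sqrt (2 * sqrt 2 - 2)"
    by (simp only:) (simp add: algebra_simps)
  moreover have "((8 * real n + 1) * (8 * real n + 7)) / ((8 * real n + 3) * (8 * real n + 5)) =
      ((real n + 1/8) * (real n + 7/8)) / ((real n + 3/8) * (real n + 5/8))" for n
    by (simp add: divide_simps) (simp add: algebra_simps)
  ultimately show "(\<lambda>n. (((8 * real n + 1) * (8 * real n + 7)) /
      ((8 * real n + 3) * (8 * real n + 5))) ^ thue_morse n) has_prod sqrt (2 * sqrt 2 - 2)"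
    using has_prod_thue_morse_Gamma[of "1/8" "7/8" "3/8" "5/8"] by simp
qed

end
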